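(* Let $0<s<1$ and let $\sigma:\mathbb{R}^N\to(0,\infty)$ be a screening function such that $0<\inf_{\mathbb{R}^N}\sigma\le\sup_{\mathbb{R}^N}\sigma<\infty$. Then there exists a constant $c=c(N,s,\sigma)>0$ such that if $f:\mathbb{R}^N\to\mathbb{R}$ is of Schwartz class, then $$c^{-1}\int_{\mathbb{R}^N}\min\{|\xi|^{2s},|\xi|^2\}|\hat f(\xi)|^2\,d\xi\le|f|^2_{\tilde{W}^{s,2}_{(\sigma)}(\mathbb{R}^N)}\le c\int_{\mathbb{R}^N}\min\{|\xi|^{2s},|\xi|^2\}|\hat f(\xi)|^2\,d\xi,$$ where $\hat f$ is the Fourier transform of $f$.
   Context: A screening function on $\mathbb{R}^N$ is a lower semicontinuous function with values in $(0,\infty]$. The seminorm is $$|f|_{\tilde{W}^{s,2}_{(\sigma)}(\mathbb{R}^N)}:=\left(\int_{\mathbb{R}^N}\int_{B(0,\sigma(x))}\frac{|f(x+h)-f(x)|^2}{|h|^{2s+N}}\,dh\,dx\right)^{1/2}.$$ The Fourier transform is normalized as $\hat f(\xi)=\int_{\mathbb{R}^N}f(x)e^{-2\pi i x\cdot\xi}\,dx$. *)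

theory Defs
  imports "HOL-Analysis.Analysis"
begin

definition lower_semicontinuous :: "('a::topological_space \<Rightarrow> ereal) \<Rightarrow> bool" where
  "lower_semicontinuous g \<longleftrightarrow> (\<forall>a. open {x. a < g x})"

definition screening_function :: "('a::euclidean_space \<Rightarrow> ereal) \<Rightarrow> bool" where
  "screening_function \<sigma> \<longleftrightarrow> lower_semicontinuous \<sigma> \<and> (\<forall>x. 0 < \<sigma> x)"

definition ennreal_sqrt :: "ennreal \<Rightarrow> ennreal" where
  "ennreal_sqrt x = (if x = \<infinity> then \<infinity> else ennreal (sqrt (enn2real x)))"

text \<open>The seminorm takes values in \<open>[0, \<infinity>]\<close>, so it is \<open>\<infinity>\<close> (and not \<open>0\<close>) when the
  double integral diverges. The integrand is \<open>0\<close> at \<open>h = 0\<close>, a null set.\<close>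

definition screened_seminorm ::
  "('a::euclidean_space \<Rightarrow> ereal) \<Rightarrow> real \<Rightarrow> ('a \<Rightarrow> real) \<Rightarrow> ennreal" where
  "screened_seminorm \<sigma> s f = ennreal_sqrt
     (\<integral>\<^sup>+ x. (\<integral>\<^sup>+ h\<in>{h. ereal (norm h) < \<sigma> x}.
         ennreal (\<bar>f (x + h) - f x\<bar>\<^sup>2 / norm h powr (2 * s + real DIM('a))) \<partial>lborel) \<partial>lborel)"

text \<open>The integral is absolutely convergent for every Schwartz function.\<close>

definition fourier_transform :: "('a::euclidean_space \<Rightarrow> real) \<Rightarrow> 'a \<Rightarrow> complex" where
  "fourier_transform f \<xi> =
     (\<integral>x. complex_of_real (f x) * exp (- 2 * complex_of_real pi * \<i> * complex_of_real (x \<bullet> \<xi>)) \<partial>lborel)"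

text \<open>\<open>iterated_partial [b\<^sub>1, \<dots>, b\<^sub>k] f\<close> is the mixed partial derivative
  \<open>\<partial>\<^sub>b\<^sub>1 \<dots> \<partial>\<^sub>b\<^sub>k f\<close> for coordinate directions \<open>b\<^sub>i \<in> Basis\<close>; a multi-index of order \<open>k\<close>
  corresponds to a list of length \<open>k\<close>.\<close>

primrec iterated_partial :: "'a list \<Rightarrow> ('a::euclidean_space \<Rightarrow> real) \<Rightarrow> 'a \<Rightarrow> real" where
  "iterated_partial [] f = f"
| "iterated_partial (b # bs) f = (\<lambda>x. frechet_derivative (iterated_partial bs f) (at x) b)"

text \<open>A function is \<open>C\<^sup>\<infinity>\<close> iff its partial derivatives of all orders exist and are
  (Frechet) differentiable everywhere; differentiability also guarantees that
  \<^const>\<open>frechet_derivative\<close> above denotes a genuine derivative.\<close>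

definition smooth :: "('a::euclidean_space \<Rightarrow> real) \<Rightarrow> bool" where
  "smooth f \<longleftrightarrow>
     (\<forall>bs. set bs \<subseteq> Basis \<longrightarrow> (\<forall>x. iterated_partial bs f differentiable (at x)))"

definition schwartz :: "('a::euclidean_space \<Rightarrow> real) \<Rightarrow> bool" where
  "schwartz f \<longleftrightarrow> smooth f \<and>
     (\<forall>k bs. set bs \<subseteq> Basis \<longrightarrow>
        bounded (range (\<lambda>x. (1 + norm x) ^ k * iterated_partial bs f x)))"

end

theory Submission
  imports Defs "HOL-Probability.Characteristic_Functions"
begin

text \<open>Since \<open>\<sigma>\<close> lies between two positive constants, the seminorm lies between two seminorms of
  constant radius \<open>r\<close>. For constant radius, Tonelli and Plancherel turn the squared seminorm into
  the integral of \<open>M(\<xi>)\<close> against the squared modulus of the Fourier transform of \<open>f\<close>, where \<open>M(\<xi>)\<close>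
  is the integral of \<open>4 sin\<^sup>2(\<pi> h \<cdot> \<xi>) / \<bar>h\<bar>^(2s+N)\<close> over \<open>\<bar>h\<bar> < r\<close>. From above, \<open>M\<close> is
  estimated with \<open>\<bar>sin t\<bar> \<le> min 1 \<bar>t\<bar>\<close>; from below, by its part on a small ball on which
  \<open>sin t \<ge> t / 2\<close>. Plancherel's formula for bounded continuous integrable functions is obtained by
  inserting a Gaussian weight and letting its width tend to infinity.\<close>

subsection \<open>Powers of the norm\<close>

lemma pred_in_ball [measurable]: "Measurable.pred borel (\<lambda>x::'a::euclidean_space. x \<in> ball c r)"
  unfolding mem_ball by measurable

text \<open>The integrand is bounded by a constant on the annulus, and the annulus is enclosed in
  the ball of radius \<open>2 * r\<close>, whose volume cancels the factor
  \<open>r ^ DIM('a)\<close>. The maximum covers both signs of \<open>p\<close>: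
  \<open>norm h powr p\<close> is largest at the outer radius if \<open>p \<ge> 0\<close> and at the
  inner radius otherwise.\<close>

lemma nn_integral_norm_powr_annulus:
  fixes p r :: real
  assumes "0 < r"
  shows "(\<integral>\<^sup>+h\<in>{h::'a::euclidean_space. r \<le> norm h \<and> norm h \<le> 2 * r}.
            ennreal (norm h powr (p - real DIM('a))) \<partial>lborel)
         \<le> ennreal (unit_ball_vol (real DIM('a)) * 2 ^ DIM('a) * max 1 (2 powr p) * r powr p)"
    (is "(\<integral>\<^sup>+h\<in>?S. _ \<partial>lborel) \<le> _")
proof -
  let ?n = "DIM('a)"
  let ?B = "max 1 (2 powr p) * r powr p / r ^ ?n"
  have bd: "norm h powr (p - real ?n) \<le> ?B" if "r \<le> norm h" "norm h \<le> 2 * r" for h :: 'a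
  proof -
    have pos: "0 < norm h" using that assms by linarith
    have "norm h powr p \<le> max 1 (2 powr p) * r powr p"
    proof (cases "p \<ge> 0")
      case True
      have "norm h powr p \<le> (2 * r) powr p"
        by (rule powr_mono2) (use True that in auto)
      also have "\<dots> = 2 powr p * r powr p" using assms by (simp add: powr_mult)
      also have "\<dots> \<le> max 1 (2 powr p) * r powr p" by (rule mult_right_mono) auto
      finally show ?thesis .
    next
      case False
      have "norm h powr p \<le> 1 * r powr p"
        using powr_mono2'[of p r "norm h"] False that assms by simp
      also have "\<dots> \<le> max 1 (2 powr p) * r powr p" by (rule mult_right_mono) auto
      finally show ?thesis .
    qed
    moreover have "r ^ ?n \<le> norm h ^ ?n" using that assms by (intro power_mono) auto
    ultimately have "norm h powr p / norm h ^ ?n \<le> ?B"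
      using assms by (intro frac_le) auto
    then show ?thesis using pos by (simp add: powr_diff powr_realpow)
  qed
  have "(\<integral>\<^sup>+h\<in>?S. ennreal (norm h powr (p - real ?n)) \<partial>lborel)
      \<le> (\<integral>\<^sup>+h. ennreal ?B * indicator (cball 0 (2 * r) :: 'a set) h \<partial>lborel)"
    by (intro nn_integral_mono) (auto simp: indicator_def intro!: ennreal_leI bd)
  also have "\<dots> = ennreal ?B * ennreal (unit_ball_vol (real ?n) * (2 * r) ^ ?n)"
    using assms by (simp add: nn_integral_cmult_indicator emeasure_cball)
  also have "\<dots> = ennreal (?B * (unit_ball_vol (real ?n) * (2 * r) ^ ?n))"
    using assms by (intro ennreal_mult[symmetric]) auto
  also have "?B * (unit_ball_vol (real ?n) * (2 * r) ^ ?n)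
      = unit_ball_vol (real ?n) * 2 ^ ?n * max 1 (2 powr p) * r powr p"
    using assms by (simp add: power_mult_distrib)
  finally show ?thesis .
qed

text \<open>Annuli with inner radii \<open>R * \<theta> ^ k\<close> cover \<open>S\<close> away from
  the origin, and their contributions form a geometric series of ratio
  \<open>\<theta> powr p\<close>. Leaving \<theta> free serves both shrinking annuli (\<theta> =
  1/2, p > 0) and growing ones (\<theta> = 2, p < 0).\<close>

lemma nn_integral_norm_powr_dyadic:
  fixes p R \<theta> :: real and S :: "'a::euclidean_space set"
  assumes "0 < R" "0 < \<theta>" "\<theta> powr p < 1" and S: "S \<in> sets borel"
    and cover: "\<And>h. h \<in> S \<Longrightarrow> h \<noteq> 0 \<Longrightarrow> \<exists>k. R * \<theta> ^ k \<le> norm h \<and> norm h \<le> 2 * (R * \<theta> ^ k)"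
  shows "(\<integral>\<^sup>+h\<in>S. ennreal (norm h powr (p - real DIM('a))) \<partial>lborel)
    \<le> ennreal (unit_ball_vol (real DIM('a)) * 2 ^ DIM('a) * max 1 (2 powr p) / (1 - \<theta> powr p)
         * R powr p)"
proof -
  let ?A = "unit_ball_vol (real DIM('a)) * 2 ^ DIM('a) * max 1 (2 powr p)"
  let ?g = "\<lambda>h::'a. ennreal (norm h powr (p - real DIM('a)))"
  let ?D = "\<lambda>k. {h::'a. R * \<theta> ^ k \<le> norm h \<and> norm h \<le> 2 * (R * \<theta> ^ k)}"
  have "(\<integral>\<^sup>+h\<in>S. ?g h \<partial>lborel) \<le> (\<integral>\<^sup>+h. (\<Sum>k. ?g h * indicator (?D k) h) \<partial>lborel)"
  proof (rule nn_integral_mono)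
    fix h :: 'a
    show "?g h * indicator S h \<le> (\<Sum>k. ?g h * indicator (?D k) h)"
    \<comment> \<open>The origin lies in no annulus, but there the left side vanishes because
      \<open>0 powr y = 0\<close> for every exponent. The annuli share boundary spheres, so a single
      term is only bounded by the sum.\<close>
    proof (cases "h \<in> S \<and> h \<noteq> 0")
      case True
      then obtain k where k: "h \<in> ?D k" using cover by blast
      have "?g h * indicator S h = (\<Sum>j\<in>{k}. ?g h * indicator (?D j) h)" using True k by simp
      also have "\<dots> \<le> (\<Sum>k. ?g h * indicator (?D k) h)" by (rule sum_le_suminf) auto
      finally show ?thesis .
    qed auto
  qed
  also have "\<dots> = (\<Sum>k. \<integral>\<^sup>+h. ?g h * indicator (?D k) h \<partial>lborel)"
    by (rule nn_integral_suminf) measurable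
  also have "\<dots> \<le> (\<Sum>k. ennreal (?A * R powr p * (\<theta> powr p) ^ k))"
  proof (rule suminf_le)
    fix k
    have "(R * \<theta> ^ k) powr p = R powr p * (\<theta> powr p) ^ k"
      using assms by (simp add: powr_mult powr_powr mult.commute flip: powr_realpow)
    then show "(\<integral>\<^sup>+h. ?g h * indicator (?D k) h \<partial>lborel) \<le> ennreal (?A * R powr p * (\<theta> powr p) ^ k)"
      using nn_integral_norm_powr_annulus[of "R * \<theta> ^ k" p, where 'a='a] assms by (simp add: mult_ac)
  qed auto
  also have "\<dots> = ennreal (\<Sum>k. ?A * R powr p * (\<theta> powr p) ^ k)"
    using assms by (intro suminf_ennreal2) (auto intro!: summable_mult summable_geometric)
  also have "(\<Sum>k. ?A * R powr p * (\<theta> powr p) ^ k) = ?A / (1 - \<theta> powr p) * R powr p"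
    using assms by (subst suminf_mult) (auto simp: suminf_geometric intro!: summable_geometric)
  finally show ?thesis .
qed

text \<open>The least \<open>k\<close> with \<open>x \<le> 2 * 2 ^ k\<close> works: minimality gives
  the lower bound if \<open>k > 0\<close>, and \<open>1 \<le> x\<close> gives it if
  \<open>k = 0\<close>.\<close>

lemma real_dyadic_interval:
  fixes x :: real
  assumes "1 \<le> x"
  shows "\<exists>k. 2 ^ k \<le> x \<and> x \<le> 2 * 2 ^ k"
proof -
  obtain k where k: "k = (LEAST k. x \<le> 2 * 2 ^ k)" by blast
  obtain m where "x < 2 ^ m" using real_arch_pow[of 2 x] by auto
  then have "x \<le> 2 * 2 ^ m" by (smt (verit) zero_le_power)
  then have 1: "x \<le> 2 * 2 ^ k" unfolding k by (rule LeastI)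
  have "2 ^ k \<le> x"
  proof (cases k)
    case (Suc j)
    then have "\<not> x \<le> 2 * 2 ^ j" using not_less_Least[of j "\<lambda>k. x \<le> 2 * 2 ^ k"] k by simp
    then show ?thesis using Suc by simp
  qed (use assms in auto)
  with 1 show ?thesis by blast
qed

lemma nn_integral_norm_powr_ball:
  fixes p :: real
  assumes "0 < p"
  obtains C where "0 < C"
    "\<And>R. 0 < R \<Longrightarrow> (\<integral>\<^sup>+h\<in>ball 0 R. ennreal (norm (h::'a::euclidean_space) powr (p - real DIM('a))) \<partial>lborel)
       \<le> ennreal (C * R powr p)"
proof
  let ?A = "unit_ball_vol (real DIM('a)) * 2 ^ DIM('a) * max 1 (2 powr p)"
  let ?C = "?A / (1 - (1/2) powr p) * (1/2) powr p"
  have lt: "(1/2) powr p < (1::real)" using assms powr_less_mono2[of p "1/2" 1] by simp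
  show "0 < ?C" using lt by (auto intro!: divide_pos_pos mult_pos_pos unit_ball_vol_pos simp: max_def)
  fix R :: real assume R: "0 < R"
  \<comment> \<open>The outermost annulus has inner radius \<open>R / 2\<close> and outer radius
    \<open>R\<close>; this halving is the source of the factor \<open>(1/2) powr p\<close> in
    \<open>?C\<close>.\<close>
  have "(\<integral>\<^sup>+h\<in>ball 0 R. ennreal (norm (h::'a) powr (p - real DIM('a))) \<partial>lborel)
     \<le> ennreal (?A / (1 - (1/2) powr p) * (R / 2) powr p)"
  proof (rule nn_integral_norm_powr_dyadic)
    fix h :: 'a assume h: "h \<in> ball 0 R" "h \<noteq> 0"
    then have "1 \<le> R / norm h" by simp
    then obtain k where "2 ^ k \<le> R / norm h" "R / norm h \<le> 2 * 2 ^ k" using real_dyadic_interval by blast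
    then show "\<exists>k. R / 2 * (1 / 2) ^ k \<le> norm h \<and> norm h \<le> 2 * (R / 2 * (1 / 2) ^ k)"
      using h by (intro exI[of _ k]) (auto simp: field_simps)
  qed (use R lt in auto)
  also have "(R / 2) powr p = (1/2) powr p * R powr p" using R powr_mult[of "1/2" R p] by simp
  finally show "(\<integral>\<^sup>+h\<in>ball 0 R. ennreal (norm (h::'a) powr (p - real DIM('a))) \<partial>lborel)
     \<le> ennreal (?C * R powr p)" by (simp add: mult_ac)
qed

lemma nn_integral_norm_powr_outside_ball:
  fixes p :: real
  assumes "0 < p"
  obtains C where "0 < C"
    "\<And>R. 0 < R \<Longrightarrow> (\<integral>\<^sup>+h\<in>- ball 0 R. ennreal (norm (h::'a::euclidean_space) powr (- p - real DIM('a))) \<partial>lborel)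
       \<le> ennreal (C * R powr (- p))"
proof
  let ?A = "unit_ball_vol (real DIM('a)) * 2 ^ DIM('a) * max 1 (2 powr (- p))"
  let ?C = "?A / (1 - 2 powr (- p))"
  have lt: "2 powr (- p) < (1::real)" using assms by (simp add: powr_less_one)
  show "0 < ?C" using lt by (auto intro!: divide_pos_pos mult_pos_pos unit_ball_vol_pos simp: max_def)
  fix R :: real assume R: "0 < R"
  show "(\<integral>\<^sup>+h\<in>- ball 0 R. ennreal (norm (h::'a) powr (- p - real DIM('a))) \<partial>lborel)
     \<le> ennreal (?C * R powr (- p))"
  proof (rule nn_integral_norm_powr_dyadic)
    fix h :: 'a assume h: "h \<in> - ball 0 R" "h \<noteq> 0"
    then have "1 \<le> norm h / R" using R by simp
    then obtain k where "2 ^ k \<le> norm h / R" "norm h / R \<le> 2 * 2 ^ k" using real_dyadic_interval by blast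
    then show "\<exists>k. R * 2 ^ k \<le> norm h \<and> norm h \<le> 2 * (R * 2 ^ k)"
      using R by (intro exI[of _ k]) (auto simp: field_simps)
  qed (use R lt in auto)
qed

subsection \<open>Plancherel's formula\<close>

lemma borel_measurable_cis [measurable]: "cis \<in> borel_measurable borel"
  by (intro borel_measurable_continuous_onI continuous_intros)

lemma fourier_transform_cis:
  "fourier_transform f \<xi> = (\<integral>x. complex_of_real (f x) * cis (- 2 * pi * (x \<bullet> \<xi>)) \<partial>lborel)"
  unfolding fourier_transform_def by (simp add: cis_conv_exp mult_ac)

text \<open>The phase has modulus one, so the product of \<open>f x\<close> and
  \<open>g \<xi>\<close> is an integrable majorant and Fubini applies. The frequency
  \<open>c\<close> is kept general because both \<open>2 * pi\<close> and \<open>- 2 * pi\<close>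
  occur below.\<close>

lemma integral_mult_cis_swap:
  fixes f g :: "'a::euclidean_space \<Rightarrow> complex" and c :: real
  assumes "integrable lborel f" "integrable lborel g"
  shows "(\<integral>\<xi>. (\<integral>x. f x * cis (c * (x \<bullet> \<xi>)) \<partial>lborel) * g \<xi> \<partial>lborel)
       = (\<integral>x. f x * (\<integral>\<xi>. g \<xi> * cis (c * (x \<bullet> \<xi>)) \<partial>lborel) \<partial>lborel)"
proof -
  have [measurable]: "f \<in> borel_measurable borel" "g \<in> borel_measurable borel"
    using assms by auto
  have "integrable (lborel \<Otimes>\<^sub>M lborel) (\<lambda>(x, \<xi>). f x * g \<xi> * cis (c * (x \<bullet> \<xi>)))"
  proof (rule lborel_pair.Fubini_integrable)
    show "integrable lborel (\<lambda>x. \<integral>\<xi>. norm (case (x, \<xi>) of (x, \<xi>) \<Rightarrow> f x * g \<xi> * cis (c * (x \<bullet> \<xi>))) \<partial>lborel)"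
      using assms by (simp add: norm_mult)
    have "integrable lborel (\<lambda>\<xi>. f x * g \<xi> * cis (c * (x \<bullet> \<xi>)))" for x
      by (rule Bochner_Integration.integrable_bound[where f="\<lambda>\<xi>. f x * g \<xi>"])
         (use assms in \<open>auto simp: norm_mult\<close>)
    then show "AE x in lborel. integrable lborel (\<lambda>\<xi>. case (x, \<xi>) of (x, \<xi>) \<Rightarrow> f x * g \<xi> * cis (c * (x \<bullet> \<xi>)))"
      by simp
  qed measurable
  from lborel_pair.Fubini_integral[OF this]
  have "(\<integral>\<xi>. (\<integral>x. f x * g \<xi> * cis (c * (x \<bullet> \<xi>)) \<partial>lborel) \<partial>lborel)
      = (\<integral>x. (\<integral>\<xi>. f x * g \<xi> * cis (c * (x \<bullet> \<xi>)) \<partial>lborel) \<partial>lborel)" .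
  moreover have "(\<integral>x. f x * g \<xi> * cis (c * (x \<bullet> \<xi>)) \<partial>lborel) = (\<integral>x. f x * cis (c * (x \<bullet> \<xi>)) \<partial>lborel) * g \<xi>" for \<xi>
    by (subst integral_mult_left_zero[symmetric]) (simp add: mult_ac)
  moreover have "(\<integral>\<xi>. f x * g \<xi> * cis (c * (x \<bullet> \<xi>)) \<partial>lborel) = f x * (\<integral>\<xi>. g \<xi> * cis (c * (x \<bullet> \<xi>)) \<partial>lborel)" for x
    by (subst integral_mult_right_zero[symmetric]) (simp add: mult_ac)
  ultimately show ?thesis by simp
qed

lemma lborel_integral_affine:
  fixes f :: "'a::euclidean_space \<Rightarrow> 'b::{banach, second_countable_topology}"
  assumes "0 < c" and f: "f \<in> borel_measurable borel"
  shows "(\<integral>x. f x \<partial>lborel) = c ^ DIM('a) *\<^sub>R (\<integral>x. f (t + c *\<^sub>R x) \<partial>lborel)"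
proof -
  have "(\<integral>x. f x \<partial>lborel) = (\<integral>x. f x \<partial>density (distr lborel borel (\<lambda>x. t + c *\<^sub>R x)) (\<lambda>_. \<bar>c\<bar> ^ DIM('a)))"
    using lborel_affine[of c t] assms by simp
  also have "\<dots> = (\<integral>x. \<bar>c\<bar> ^ DIM('a) *\<^sub>R f x \<partial>distr lborel borel (\<lambda>x. t + c *\<^sub>R x))"
    using f by (subst integral_density) auto
  also have "\<dots> = (\<integral>x. c ^ DIM('a) *\<^sub>R f (t + c *\<^sub>R x) \<partial>lborel)"
    using f assms by (subst integral_distr) auto
  finally show ?thesis by simp
qed

lemma lborel_integrable_affine:
  fixes f :: "'a::euclidean_space \<Rightarrow> 'b::{banach, second_countable_topology}"
  assumes "0 < c" and f: "integrable lborel f"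
  shows "integrable lborel (\<lambda>x. f (t + c *\<^sub>R x))"
proof -
  have "integrable (density (distr lborel borel (\<lambda>x. t + c *\<^sub>R x)) (\<lambda>_. ennreal (\<bar>c\<bar> ^ DIM('a)))) f"
    using lborel_affine[of c t] assms by simp
  then have "integrable lborel (\<lambda>x. c ^ DIM('a) *\<^sub>R f (t + c *\<^sub>R x))"
    using assms by (subst (asm) integrable_density) (auto simp: integrable_distr_eq)
  from integrable_scaleR_right[OF this, of "1 / c ^ DIM('a)"] show ?thesis
    using assms by simp
qed

section \<open>The Gaussian as its own Fourier transform\<close>

text \<open>This is the characteristic function of the standard normal distribution,
  rescaled.\<close>

lemma gaussian_real:
  shows "integrable lborel (\<lambda>t::real. exp (- pi * t\<^sup>2))"
    and "(\<integral>t. complex_of_real (exp (- pi * t\<^sup>2)) * cis (2 * pi * (w * t)) \<partial>lborel) = exp (- pi * w\<^sup>2)"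
proof -
  \<comment> \<open>Substituting \<open>?k * t\<close> turns the exponent of the normal density into
    \<open>- pi * t\<^sup>2\<close>; the Jacobian \<open>?k\<close> cancels the normalization of the
    density.\<close>
  let ?k = "sqrt (2 * pi)"
  have k: "0 < ?k" by simp
  have dens: "std_normal_density (0 + ?k *\<^sub>R t) = exp (- pi * t\<^sup>2) / ?k" for t
    by (simp add: std_normal_density_def power_mult_distrib)
  have "integrable lborel (\<lambda>t. std_normal_density (0 + ?k *\<^sub>R t))"
    by (rule lborel_integrable_affine[OF k]) auto
  then show "integrable lborel (\<lambda>t::real. exp (- pi * t\<^sup>2))"
    unfolding dens using integrable_mult_right[where c="?k"] by fastforce
  have "complex_of_real (exp (- pi * w\<^sup>2)) = char std_normal_distribution (?k * w)"
    by (simp add: char_std_normal_distribution power_mult_distrib)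
  also have "\<dots> = (\<integral>t. std_normal_density t *\<^sub>R iexp (?k * w * t) \<partial>lborel)"
    unfolding char_def by (subst integral_density) auto
  also have "\<dots> = ?k ^ DIM(real) *\<^sub>R (\<integral>t. std_normal_density (0 + ?k *\<^sub>R t) *\<^sub>R iexp (?k * w * (0 + ?k *\<^sub>R t)) \<partial>lborel)"
    by (rule lborel_integral_affine[OF k]) auto
  also have "\<dots> = (\<integral>t. ?k *\<^sub>R (std_normal_density (0 + ?k *\<^sub>R t) *\<^sub>R iexp (?k * w * (0 + ?k *\<^sub>R t))) \<partial>lborel)"
    by (simp only: DIM_real power_one_right integral_scaleR_right)
  also have "\<dots> = (\<integral>t. complex_of_real (exp (- pi * t\<^sup>2)) * cis (2 * pi * (w * t)) \<partial>lborel)"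
  proof (rule Bochner_Integration.integral_cong[OF refl])
    fix t :: real
    have "?k * w * (0 + ?k *\<^sub>R t) = 2 * pi * (w * t)"
      by (simp add: algebra_simps flip: power2_eq_square)
    then show "?k *\<^sub>R (std_normal_density (0 + ?k *\<^sub>R t) *\<^sub>R iexp (?k * w * (0 + ?k *\<^sub>R t)))
       = complex_of_real (exp (- pi * t\<^sup>2)) * cis (2 * pi * (w * t))"
      unfolding dens by (simp only: cis_conv_exp) (simp add: scaleR_conv_of_real)
  qed
  finally show "(\<integral>t. complex_of_real (exp (- pi * t\<^sup>2)) * cis (2 * pi * (w * t)) \<partial>lborel) = exp (- pi * w\<^sup>2)" ..
qed

lemma cis_sum: "finite A \<Longrightarrow> cis (\<Sum>a\<in>A. f a) = (\<Prod>a\<in>A. cis (f a))"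
  by (induction A rule: finite_induct) (auto simp: cis_mult[symmetric])

text \<open>Lebesgue measure is the image of the product measure under the coordinate map
  \<open>?T\<close>. The Gaussian and the phase both factor over \<open>Basis\<close>, which reduces
  everything to one dimension.\<close>

lemma gaussian:
  fixes w :: "'a::euclidean_space"
  shows "integrable lborel (\<lambda>x::'a. exp (- pi * (norm x)\<^sup>2))"
    and "(\<integral>x. complex_of_real (exp (- pi * (norm x)\<^sup>2)) * cis (2 * pi * (w \<bullet> x)) \<partial>lborel)
           = exp (- pi * (norm w)\<^sup>2)"
proof -
  interpret product_sigma_finite "\<lambda>_::'a. lborel :: real measure" ..
  let ?g = "\<lambda>b t. complex_of_real (exp (- pi * t\<^sup>2)) * cis (2 * pi * ((w \<bullet> b) * t))"
  let ?T = "\<lambda>f. \<Sum>b\<in>Basis. f b *\<^sub>R b :: 'a"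
  have norm_sq: "(norm x)\<^sup>2 = (\<Sum>b\<in>Basis. (x \<bullet> b)\<^sup>2)" for x :: 'a
    by (simp add: norm_eq_sqrt_inner euclidean_inner[of x x] power2_eq_square sum_nonneg)
  have gauss_T: "exp (- pi * (norm (?T f))\<^sup>2) = (\<Prod>b\<in>Basis. exp (- pi * (f b)\<^sup>2))" for f
    unfolding norm_sq by (simp add: exp_sum[symmetric] sum_distrib_left sum_negf)
  have "w \<bullet> ?T f = (\<Sum>b\<in>Basis. (w \<bullet> b) * f b)" for f
    by (simp add: inner_sum_right mult.commute)
  then have cis_T: "cis (2 * pi * (w \<bullet> ?T f)) = (\<Prod>b\<in>Basis. cis (2 * pi * ((w \<bullet> b) * f b)))" for f
    by (simp add: sum_distrib_left cis_sum)
  have "integrable (\<Pi>\<^sub>M b\<in>Basis. lborel) (\<lambda>f. \<Prod>b\<in>(Basis::'a set). exp (- pi * (f b)\<^sup>2))"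
    by (rule product_integrable_prod[OF finite_Basis gaussian_real(1)])
  then show "integrable lborel (\<lambda>x::'a. exp (- pi * (norm x)\<^sup>2))"
    by (subst lborel_eq, subst integrable_distr_eq) (auto simp: gauss_T[unfolded mult_minus_left])
  have int: "integrable lborel (?g b)" for b
    by (rule Bochner_Integration.integrable_bound[OF gaussian_real(1)]) (auto simp: norm_mult)
  have "(\<integral>x. complex_of_real (exp (- pi * (norm x)\<^sup>2)) * cis (2 * pi * (w \<bullet> x)) \<partial>lborel)
     = (\<integral>f. (\<Prod>b\<in>Basis. ?g b (f b)) \<partial>(\<Pi>\<^sub>M b\<in>Basis. lborel))"
    by (subst lborel_eq, subst integral_distr) (auto simp: gauss_T[unfolded mult_minus_left] cis_T prod.distrib)
  also have "\<dots> = (\<Prod>b\<in>Basis. integral\<^sup>L lborel (?g b))"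
    by (rule product_integral_prod[OF finite_Basis int])
  also have "\<dots> = (\<Prod>b\<in>Basis. complex_of_real (exp (- pi * (w \<bullet> b)\<^sup>2)))"
    by (intro prod.cong refl gaussian_real)
  also have "\<dots> = exp (- pi * (norm w)\<^sup>2)"
    unfolding norm_sq by (simp add: exp_sum[symmetric] sum_distrib_left sum_negf flip: of_real_prod)
  finally show "(\<integral>x. complex_of_real (exp (- pi * (norm x)\<^sup>2)) * cis (2 * pi * (w \<bullet> x)) \<partial>lborel)
           = exp (- pi * (norm w)\<^sup>2)" .
qed

lemma gaussian_mass: "(\<integral>x. exp (- pi * (norm (x::'a::euclidean_space))\<^sup>2) \<partial>lborel) = 1"
proof -
  have "complex_of_real (\<integral>x. exp (- pi * (norm (x::'a))\<^sup>2) \<partial>lborel) = 1"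
    using gaussian(2)[of "0::'a"] by (simp flip: integral_complex_of_real)
  then show ?thesis by (simp only: of_real_eq_1_iff)
qed

text \<open>A wide Gaussian weight in frequency becomes a narrow kernel of width \<delta> in space,
  by the substitution of \<delta> \<xi> for the variable. This kernel is the approximate identity
  behind Plancherel's formula.\<close>

lemma integral_gaussian_dilated:
  fixes y :: "'a::euclidean_space"
  assumes "0 < \<delta>"
  shows "(\<integral>\<xi>. complex_of_real (exp (- pi * (norm (\<delta> *\<^sub>R \<xi>))\<^sup>2)) * cis (2 * pi * (y \<bullet> \<xi>)) \<partial>lborel)
       = complex_of_real (exp (- pi * (norm (y /\<^sub>R \<delta>))\<^sup>2) / \<delta> ^ DIM('a))"
proof -
  let ?G = "\<lambda>\<eta>::'a. complex_of_real (exp (- pi * (norm \<eta>)\<^sup>2)) * cis (2 * pi * ((y /\<^sub>R \<delta>) \<bullet> \<eta>))"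
  have G: "?G (0 + \<delta> *\<^sub>R \<xi>) = complex_of_real (exp (- pi * (norm (\<delta> *\<^sub>R \<xi>))\<^sup>2)) * cis (2 * pi * (y \<bullet> \<xi>))" for \<xi>
    using assms by (simp add: field_simps)
  have "complex_of_real (exp (- pi * (norm (y /\<^sub>R \<delta>))\<^sup>2)) = (\<integral>\<eta>. ?G \<eta> \<partial>lborel)"
    by (rule gaussian(2)[symmetric])
  also have "\<dots> = \<delta> ^ DIM('a) *\<^sub>R (\<integral>\<xi>. ?G (0 + \<delta> *\<^sub>R \<xi>) \<partial>lborel)"
    by (rule lborel_integral_affine[OF assms]) measurable
  finally show ?thesis
    unfolding G using assms by (simp add: scaleR_conv_of_real field_simps)
qed

section \<open>Gaussian-weighted energy and its limit\<close>

lemma norm_fourier_transform_le: "cmod (fourier_transform f \<xi>) \<le> (\<integral>x. \<bar>f x\<bar> \<partial>lborel)"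
  unfolding fourier_transform_cis
  by (rule order_trans[OF integral_norm_bound]) (simp add: norm_mult)

lemma borel_measurable_fourier_transform [measurable]:
  fixes f :: "'a::euclidean_space \<Rightarrow> real"
  assumes [measurable]: "f \<in> borel_measurable borel"
  shows "fourier_transform f \<in> borel_measurable borel"
  unfolding fourier_transform_cis by measurable

text \<open>The squared modulus is written as the transform times its conjugate, and each factor is
  unfolded by one exchange of integrals. The transform is bounded, so the Gaussian weight makes both
  exchanges legitimate.\<close>

lemma gaussian_fourier_energy:
  fixes f :: "'a::euclidean_space \<Rightarrow> real"
  assumes "0 < \<delta>" and f: "integrable lborel f"
  shows "(\<integral>\<xi>. (cmod (fourier_transform f \<xi>))\<^sup>2 * exp (- pi * (norm (\<delta> *\<^sub>R \<xi>))\<^sup>2) \<partial>lborel)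
       = (\<integral>x. f x * (\<integral>z. f (x + \<delta> *\<^sub>R z) * exp (- pi * (norm z)\<^sup>2) \<partial>lborel) \<partial>lborel)"
proof -
  have [measurable]: "f \<in> borel_measurable borel" using f by auto
  let ?F = "fourier_transform f" and ?e = "\<lambda>\<xi>::'a. exp (- pi * (norm (\<delta> *\<^sub>R \<xi>))\<^sup>2)"
  let ?f = "\<lambda>x. complex_of_real (f x)"
  have [measurable]: "cnj \<in> borel_measurable borel"
    by (intro borel_measurable_continuous_onI continuous_intros)
  have cf: "integrable lborel ?f" using f by simp
  have e: "integrable lborel ?e"
    using lborel_integrable_affine[OF assms(1) gaussian(1), of 0] by simp
  have F_cnj: "cnj (?F \<xi>) = (\<integral>y. ?f y * cis (2 * pi * (y \<bullet> \<xi>)) \<partial>lborel)" for \<xi>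
    unfolding fourier_transform_cis by (simp add: cis_cnj flip: Bochner_Integration.integral_cnj)
  have g: "integrable lborel (\<lambda>\<xi>. cnj (?F \<xi>) * complex_of_real (?e \<xi>))"
  proof (rule Bochner_Integration.integrable_bound)
    show "integrable lborel (\<lambda>\<xi>. (\<integral>x. \<bar>f x\<bar> \<partial>lborel) * ?e \<xi>)" using e by (rule integrable_mult_right)
    show "AE \<xi> in lborel. norm (cnj (?F \<xi>) * complex_of_real (?e \<xi>)) \<le> norm ((\<integral>x. \<bar>f x\<bar> \<partial>lborel) * ?e \<xi>)"
      by (intro always_eventually allI) (simp add: norm_mult abs_mult mult_right_mono norm_fourier_transform_le)
  qed measurable
  \<comment> \<open>The two phases combine to the frequency integral of a Gaussian at
    \<open>y - x\<close>. Hence transforming the weighted conjugate gives an average of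
    \<open>f\<close> around \<open>x\<close> at scale \<delta>.\<close>
  have inner: "(\<integral>\<xi>. (cnj (?F \<xi>) * complex_of_real (?e \<xi>)) * cis (- 2 * pi * (x \<bullet> \<xi>)) \<partial>lborel)
       = complex_of_real (\<integral>z. f (x + \<delta> *\<^sub>R z) * exp (- pi * (norm z)\<^sup>2) \<partial>lborel)" (is "?L = _") for x
  proof -
    have cx: "integrable lborel (\<lambda>\<xi>. complex_of_real (?e \<xi>) * cis (- 2 * pi * (x \<bullet> \<xi>)))"
      by (rule Bochner_Integration.integrable_bound[OF e]) (auto simp: norm_mult)
    have "?L = (\<integral>\<xi>. (\<integral>y. ?f y * cis (2 * pi * (y \<bullet> \<xi>)) \<partial>lborel)
          * (complex_of_real (?e \<xi>) * cis (- 2 * pi * (x \<bullet> \<xi>))) \<partial>lborel)"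
      unfolding F_cnj by (simp add: mult_ac)
    also have "\<dots> = (\<integral>y. ?f y * (\<integral>\<xi>. (complex_of_real (?e \<xi>) * cis (- 2 * pi * (x \<bullet> \<xi>)))
          * cis (2 * pi * (y \<bullet> \<xi>)) \<partial>lborel) \<partial>lborel)"
      by (rule integral_mult_cis_swap[OF cf cx])
    also have "\<dots> = (\<integral>y. ?f y * (\<integral>\<xi>. complex_of_real (?e \<xi>) * cis (2 * pi * ((y - x) \<bullet> \<xi>)) \<partial>lborel) \<partial>lborel)"
      unfolding mult.assoc cis_mult by (simp add: inner_diff_left algebra_simps)
    also have "\<dots> = (\<integral>y. complex_of_real (f y * (exp (- pi * (norm ((y - x) /\<^sub>R \<delta>))\<^sup>2) / \<delta> ^ DIM('a))) \<partial>lborel)"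
      by (simp only: integral_gaussian_dilated[OF assms(1)] of_real_mult)
    also have "\<dots> = complex_of_real (\<integral>y. f y * (exp (- pi * (norm ((y - x) /\<^sub>R \<delta>))\<^sup>2) / \<delta> ^ DIM('a)) \<partial>lborel)"
      by (rule integral_complex_of_real)
    \<comment> \<open>Substitution of \<open>x + \<delta> *\<^sub>R z\<close> for \<open>y\<close>;
      its Jacobian cancels the division by \<open>\<delta> ^ DIM('a)\<close>.\<close>
    also have "(\<integral>y. f y * (exp (- pi * (norm ((y - x) /\<^sub>R \<delta>))\<^sup>2) / \<delta> ^ DIM('a)) \<partial>lborel)
      = (\<integral>z. f (x + \<delta> *\<^sub>R z) * exp (- pi * (norm z)\<^sup>2) \<partial>lborel)"
      using assms(1)
      by (subst lborel_integral_affine[OF assms(1), where t=x]) auto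
    finally show ?thesis .
  qed
  have "complex_of_real (\<integral>\<xi>. (cmod (?F \<xi>))\<^sup>2 * ?e \<xi> \<partial>lborel)
      = (\<integral>\<xi>. ?F \<xi> * (cnj (?F \<xi>) * complex_of_real (?e \<xi>)) \<partial>lborel)"
    by (subst integral_complex_of_real[symmetric])
       (simp only: of_real_mult complex_norm_square mult.assoc)
  also have "\<dots> = (\<integral>x. ?f x * complex_of_real (\<integral>z. f (x + \<delta> *\<^sub>R z) * exp (- pi * (norm z)\<^sup>2) \<partial>lborel) \<partial>lborel)"
    using integral_mult_cis_swap[OF cf g, of "- 2 * pi"]
    unfolding inner by (simp only: fourier_transform_cis[symmetric])
  also have "\<dots> = complex_of_real (\<integral>x. f x * (\<integral>z. f (x + \<delta> *\<^sub>R z) * exp (- pi * (norm z)\<^sup>2) \<partial>lborel) \<partial>lborel)"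
    by (simp only: of_real_mult[symmetric] integral_complex_of_real)
  finally show ?thesis by (simp only: of_real_eq_iff)
qed

text \<open>Dominated convergence is applied twice. Inside, \<open>B\<close> times the Gaussian
  dominates; continuity and the unit mass of the Gaussian make the averages tend to
  \<open>f x\<close>. Outside, the averages are bounded by \<open>B\<close>, so
  \<open>\<bar>f x\<bar> * B\<close> dominates.\<close>

lemma gaussian_fourier_energy_tendsto:
  fixes f :: "'a::euclidean_space \<Rightarrow> real"
  assumes cont: "continuous_on UNIV f" and f: "integrable lborel f" and bound: "\<And>x. \<bar>f x\<bar> \<le> B"
    and \<delta>: "\<delta> \<longlonglongrightarrow> 0"
  shows "(\<lambda>n. \<integral>x. f x * (\<integral>z. f (x + \<delta> n *\<^sub>R z) * exp (- pi * (norm z)\<^sup>2) \<partial>lborel) \<partial>lborel)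
     \<longlonglongrightarrow> (\<integral>x. (f x)\<^sup>2 \<partial>lborel)"
proof (rule integral_dominated_convergence[where w="\<lambda>x. \<bar>f x\<bar> * B"])
  have [measurable]: "f \<in> borel_measurable borel" using f by auto
  let ?e = "\<lambda>z::'a. exp (- pi * (norm z)\<^sup>2)"
  let ?u = "\<lambda>n x. \<integral>z. f (x + \<delta> n *\<^sub>R z) * ?e z \<partial>lborel"
  have B: "integrable lborel (\<lambda>z. B * ?e z)" using gaussian(1) by (rule integrable_mult_right)
  have B0: "0 \<le> B" using bound[of 0] by linarith
  show "integrable lborel (\<lambda>x. \<bar>f x\<bar> * B)" using f by simp
  show "(\<lambda>x. (f x)\<^sup>2) \<in> borel_measurable lborel" by measurable
  show "(\<lambda>x. f x * ?u n x) \<in> borel_measurable lborel" for n by measurable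
  have pw: "norm (f (x + \<delta> n *\<^sub>R z) * ?e z) \<le> B * ?e z" for n x z
    using bound by (auto simp: abs_mult intro!: mult_right_mono)
  have "\<bar>?u n x\<bar> \<le> B" for n x
  proof -
    have "norm (?u n x) \<le> (\<integral>z. B * ?e z \<partial>lborel)"
      by (rule Bochner_Integration.integral_norm_bound_integral[OF _ B pw])
         (rule Bochner_Integration.integrable_bound[OF B], measurable, use pw B0 in auto)
    then show ?thesis using gaussian_mass[where 'a='a] by simp
  qed
  then show "AE x in lborel. norm (f x * ?u n x) \<le> \<bar>f x\<bar> * B" for n
    by (auto simp: abs_mult intro!: mult_left_mono)
  have "(\<lambda>n. ?u n x) \<longlonglongrightarrow> f x" for x
  proof -
    have "(\<lambda>n. ?u n x) \<longlonglongrightarrow> (\<integral>z. f x * ?e z \<partial>lborel)"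
    proof (rule integral_dominated_convergence[OF _ _ B])
      have "(\<lambda>n. f (x + \<delta> n *\<^sub>R z)) \<longlonglongrightarrow> f x" for z
      proof (rule isCont_tendsto_compose[where g=f])
        show "isCont f x" using cont by (simp add: continuous_on_eq_continuous_at)
        show "(\<lambda>n. x + \<delta> n *\<^sub>R z) \<longlonglongrightarrow> x" using \<delta> by (auto intro!: tendsto_eq_intros)
      qed
      then show "AE z in lborel. (\<lambda>n. f (x + \<delta> n *\<^sub>R z) * ?e z) \<longlonglongrightarrow> f x * ?e z"
        by (intro always_eventually allI tendsto_intros)
    qed (use pw in auto)
    then show ?thesis using gaussian_mass[where 'a='a] by simp
  qed
  then show "AE x in lborel. (\<lambda>n. f x * ?u n x) \<longlonglongrightarrow> (f x)\<^sup>2"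
    by (auto simp: power2_eq_square intro!: tendsto_intros)
qed

text \<open>Both sides are limits of the same sequence of Gaussian-weighted energies: the left one
  by monotone convergence, the right one by the preceding lemma. With nonnegative integrals, square
  integrability of the transform need not be known beforehand.\<close>

theorem plancherel:
  fixes f :: "'a::euclidean_space \<Rightarrow> real"
  assumes cont: "continuous_on UNIV f" and f: "integrable lborel f" and bound: "\<And>x. \<bar>f x\<bar> \<le> B"
  shows "(\<integral>\<^sup>+\<xi>. ennreal ((cmod (fourier_transform f \<xi>))\<^sup>2) \<partial>lborel) = (\<integral>\<^sup>+x. ennreal ((f x)\<^sup>2) \<partial>lborel)"
proof (rule LIMSEQ_unique)
  have [measurable]: "f \<in> borel_measurable borel" using f by auto
  let ?F = "fourier_transform f"
  define \<delta> :: "nat \<Rightarrow> real" where "\<delta> n = 1 / Suc n" for n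
  have \<delta>_pos: "0 < \<delta> n" for n by (simp add: \<delta>_def)
  have \<delta>_lim: "\<delta> \<longlonglongrightarrow> 0" unfolding \<delta>_def by (rule LIMSEQ_Suc[OF lim_1_over_n])
  let ?e = "\<lambda>n \<xi>::'a. exp (- pi * (norm (\<delta> n *\<^sub>R \<xi>))\<^sup>2)"
  let ?I = "\<lambda>n. \<integral>\<^sup>+\<xi>. ennreal ((cmod (?F \<xi>))\<^sup>2 * ?e n \<xi>) \<partial>lborel"
  show "?I \<longlonglongrightarrow> (\<integral>\<^sup>+\<xi>. ennreal ((cmod (?F \<xi>))\<^sup>2) \<partial>lborel)"
  proof (rule nn_integral_LIMSEQ)
    show "incseq (\<lambda>n \<xi>. ennreal ((cmod (?F \<xi>))\<^sup>2 * ?e n \<xi>))"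
    proof (intro monoI le_funI ennreal_leI mult_left_mono)
      fix m n :: nat and \<xi> :: 'a assume "m \<le> n"
      then have "norm (\<delta> n *\<^sub>R \<xi>) \<le> norm (\<delta> m *\<^sub>R \<xi>)"
        by (auto simp: \<delta>_def intro!: mult_right_mono divide_left_mono)
      then show "?e m \<xi> \<le> ?e n \<xi>" by (simp add: power_mono)
    qed auto
    fix \<xi>
    have "(\<lambda>n. (cmod (?F \<xi>))\<^sup>2 * ?e n \<xi>) \<longlonglongrightarrow> (cmod (?F \<xi>))\<^sup>2 * exp (- pi * (norm ((0::real) *\<^sub>R \<xi>))\<^sup>2)"
      by (intro tendsto_intros \<delta>_lim)
    then show "(\<lambda>n. ennreal ((cmod (?F \<xi>))\<^sup>2 * ?e n \<xi>)) \<longlonglongrightarrow> ennreal ((cmod (?F \<xi>))\<^sup>2)"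
      by (intro tendsto_ennrealI) simp
  qed measurable
  have int: "integrable lborel (\<lambda>\<xi>. (cmod (?F \<xi>))\<^sup>2 * ?e n \<xi>)" for n
  proof (rule Bochner_Integration.integrable_bound)
    have "integrable lborel (?e n)"
      using lborel_integrable_affine[OF \<delta>_pos gaussian(1), of 0] by simp
    then show "integrable lborel (\<lambda>\<xi>. (\<integral>x. \<bar>f x\<bar> \<partial>lborel)\<^sup>2 * ?e n \<xi>)" by (rule integrable_mult_right)
    show "AE \<xi> in lborel. norm ((cmod (?F \<xi>))\<^sup>2 * ?e n \<xi>) \<le> norm ((\<integral>x. \<bar>f x\<bar> \<partial>lborel)\<^sup>2 * ?e n \<xi>)"
      by (intro always_eventually allI)
         (simp add: abs_mult mult_right_mono power_mono norm_fourier_transform_le)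
  qed measurable
  have I: "?I n = ennreal (\<integral>x. f x * (\<integral>z. f (x + \<delta> n *\<^sub>R z) * exp (- pi * (norm z)\<^sup>2) \<partial>lborel) \<partial>lborel)" for n
    using nn_integral_eq_integral[OF int] gaussian_fourier_energy[OF \<delta>_pos f] by simp
  \<comment> \<open>A bounded integrable function is square integrable, so the spatial side is a
    finite real number and the real limit transfers to \<open>ennreal\<close>.\<close>
  have "integrable lborel (\<lambda>x. (f x)\<^sup>2)"
  proof (rule Bochner_Integration.integrable_bound)
    show "integrable lborel (\<lambda>x. B * f x)" using f by simp
    show "AE x in lborel. norm ((f x)\<^sup>2) \<le> norm (B * f x)"
      using order_trans[OF bound abs_ge_self]
      by (auto simp: power2_eq_square abs_mult intro!: mult_right_mono simp del: abs_mult_self_eq)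
  qed measurable
  then have sq: "(\<integral>\<^sup>+x. ennreal ((f x)\<^sup>2) \<partial>lborel) = ennreal (\<integral>x. (f x)\<^sup>2 \<partial>lborel)"
    by (rule nn_integral_eq_integral) simp
  show "?I \<longlonglongrightarrow> (\<integral>\<^sup>+x. ennreal ((f x)\<^sup>2) \<partial>lborel)"
    unfolding I sq by (intro tendsto_ennrealI gaussian_fourier_energy_tendsto[OF cont f bound \<delta>_lim])
qed

text \<open>Translation by \<open>h\<close> multiplies the transform by
  \<open>cis (2 * pi * (h \<bullet> \<xi>))\<close>, and the squared modulus of
  \<open>cis (2 * t) - 1\<close> is \<open>4 * (sin t)\<^sup>2\<close>.\<close>

lemma fourier_transform_difference:
  fixes f :: "'a::euclidean_space \<Rightarrow> real"
  assumes f: "integrable lborel f"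
  shows "(cmod (fourier_transform (\<lambda>x. f (x + h) - f x) \<xi>))\<^sup>2
    = 4 * (sin (pi * (h \<bullet> \<xi>)))\<^sup>2 * (cmod (fourier_transform f \<xi>))\<^sup>2"
proof -
  have [measurable]: "f \<in> borel_measurable borel" using f by auto
  have fh: "integrable lborel (\<lambda>x. f (x + h))"
    using lborel_integrable_affine[of 1 f h] f by (simp add: add.commute)
  have ci: "integrable lborel (\<lambda>x. complex_of_real (g x) * cis (t x))"
    if "integrable lborel g" "t \<in> borel_measurable borel" for g :: "'a \<Rightarrow> real" and t
    by (rule Bochner_Integration.integrable_bound[OF that(1)]) (use that in \<open>auto simp: norm_mult\<close>)
  have "fourier_transform f \<xi> = (\<integral>x. complex_of_real (f (h + 1 *\<^sub>R x)) * cis (- 2 * pi * ((h + 1 *\<^sub>R x) \<bullet> \<xi>)) \<partial>lborel)"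
    unfolding fourier_transform_cis
    by (subst lborel_integral_affine[of 1 _ h]) auto
  also have "\<dots> = (\<integral>x. cis (- 2 * pi * (h \<bullet> \<xi>)) * (complex_of_real (f (x + h)) * cis (- 2 * pi * (x \<bullet> \<xi>))) \<partial>lborel)"
    by (intro Bochner_Integration.integral_cong refl)
       (simp add: cis_mult inner_add_left algebra_simps)
  also have "\<dots> = cis (- 2 * pi * (h \<bullet> \<xi>)) * fourier_transform (\<lambda>x. f (x + h)) \<xi>"
    unfolding fourier_transform_cis by simp
  finally have "fourier_transform (\<lambda>x. f (x + h)) \<xi> = cis (2 * pi * (h \<bullet> \<xi>)) * fourier_transform f \<xi>"
    by (simp add: mult.assoc[symmetric] cis_mult)
  moreover have "fourier_transform (\<lambda>x. f (x + h) - f x) \<xi> = fourier_transform (\<lambda>x. f (x + h)) \<xi> - fourier_transform f \<xi>"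
    unfolding fourier_transform_cis
    by (subst Bochner_Integration.integral_diff[symmetric]) (auto intro!: ci f fh simp: left_diff_distrib)
  ultimately have "fourier_transform (\<lambda>x. f (x + h) - f x) \<xi> = (cis (2 * pi * (h \<bullet> \<xi>)) - 1) * fourier_transform f \<xi>"
    by (simp add: algebra_simps)
  moreover have "(cmod (cis (2 * t) - 1))\<^sup>2 = 4 * (sin t)\<^sup>2" for t
  proof -
    have "(cmod (cis (2 * t) - 1))\<^sup>2 = (cos (2 * t))\<^sup>2 + (sin (2 * t))\<^sup>2 + 1 - 2 * cos (2 * t)"
      by (simp add: cmod_power2 power2_diff)
    also have "\<dots> = 2 - 2 * cos (2 * t)" by simp
    finally show ?thesis by (simp add: cos_double_sin)
  qed
  from this[of "pi * (h \<bullet> \<xi>)"] have "(cmod (cis (2 * pi * (h \<bullet> \<xi>)) - 1))\<^sup>2 = 4 * (sin (pi * (h \<bullet> \<xi>)))\<^sup>2"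
    by (simp add: mult.assoc)
  ultimately show ?thesis by (simp add: norm_mult power_mult_distrib)
qed

subsection \<open>Schwartz functions\<close>

text \<open>All three facts come from the empty list of derivatives: differentiability gives
  continuity, weight exponent 0 gives boundedness, and weight exponent \<open>DIM('a) + 1\<close>
  gives decay that is integrable at infinity.\<close>

lemma schwartz_imp:
  fixes f :: "'a::euclidean_space \<Rightarrow> real"
  assumes "schwartz f"
  shows schwartz_continuous: "continuous_on UNIV f"
    and schwartz_bounded: "\<exists>B. \<forall>x. \<bar>f x\<bar> \<le> B"
    and schwartz_integrable: "integrable lborel f"
proof -
  have "\<forall>x. iterated_partial [] f differentiable (at x)"
    using assms unfolding schwartz_def smooth_def by (metis empty_iff list.set(1) subsetI)
  then show cont: "continuous_on UNIV f"
    by (auto simp: continuous_on_eq_continuous_at intro: differentiable_imp_continuous_within)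
  have bdd: "\<exists>B. \<forall>x. (1 + norm x) ^ k * \<bar>f x\<bar> \<le> B" for k
  proof -
    have "bounded (range (\<lambda>x. (1 + norm x) ^ k * iterated_partial [] f x))"
      using assms unfolding schwartz_def by (metis empty_iff list.set(1) subsetI)
    then show ?thesis by (auto simp: bounded_iff abs_mult)
  qed
  show bounded: "\<exists>B. \<forall>x. \<bar>f x\<bar> \<le> B" using bdd[of 0] by simp
  obtain B where B: "\<And>x. \<bar>f x\<bar> \<le> B" using bounded by blast
  obtain C where C: "\<And>x. (1 + norm x) ^ (DIM('a) + 1) * \<bar>f x\<bar> \<le> C" using bdd by blast
  have C0: "0 \<le> C" using C[of 0] by (smt (verit) abs_ge_zero mult_nonneg_nonneg norm_zero zero_le_power)
  have B0: "0 \<le> B" using B[of 0] by linarith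
  have [measurable]: "f \<in> borel_measurable borel" by (rule borel_measurable_continuous_onI[OF cont])
  obtain K where K: "\<And>R. 0 < R \<Longrightarrow>
      (\<integral>\<^sup>+h\<in>- ball 0 R. ennreal (norm (h::'a) powr (- 1 - real DIM('a))) \<partial>lborel) \<le> ennreal (K * R powr (- 1))"
    using nn_integral_norm_powr_outside_ball[of 1, where 'a='a] by auto
  have decay: "\<bar>f x\<bar> \<le> C * norm x powr (- 1 - real DIM('a))" if "1 \<le> norm x" for x
  proof -
    have "norm x ^ (DIM('a) + 1) * \<bar>f x\<bar> \<le> C"
      by (rule order_trans[OF _ C[of x]]) (intro mult_right_mono power_mono; simp)
    moreover have "x \<noteq> 0" using that by auto
    moreover have "norm x powr (- 1 - real DIM('a)) = inverse (norm x ^ (DIM('a) + 1))"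
      using that \<open>x \<noteq> 0\<close> powr_minus[of "norm x" "real (DIM('a) + 1)"] powr_realpow[of "norm x" "DIM('a) + 1"]
      by (simp add: algebra_simps)
    ultimately show ?thesis
      by (simp only: divide_inverse[symmetric]) (simp add: pos_le_divide_eq mult.commute)
  qed
  \<comment> \<open>The constant \<open>B\<close> bounds \<open>f\<close> on the unit ball and the
    decay estimate bounds it outside, where the power integral with \<open>p = 1\<close> is
    finite.\<close>
  have "(\<integral>\<^sup>+x. ennreal \<bar>f x\<bar> \<partial>lborel) \<le> (\<integral>\<^sup>+x. ennreal B * indicator (ball 0 1) x
      + ennreal C * (ennreal (norm (x::'a) powr (- 1 - real DIM('a))) * indicator (- ball 0 1) x) \<partial>lborel)"
    by (intro nn_integral_mono) (auto simp: indicator_def B decay C0 intro!: ennreal_leI simp flip: ennreal_mult)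
  also have "\<dots> \<le> ennreal B * emeasure lborel (ball (0::'a) 1) + ennreal C * ennreal (K * 1 powr (- 1))"
    using K[of 1] by (subst nn_integral_add) (auto simp: nn_integral_cmult nn_integral_cmult_indicator intro!: mult_left_mono)
  also have "\<dots> < \<infinity>"
    by (auto simp: ennreal_mult_less_top less_top[symmetric] emeasure_ball ennreal_mult_eq_top_iff)
  finally show "integrable lborel f" by (intro integrableI_bounded) auto
qed

subsection \<open>The Fourier symbol of the seminorm\<close>

text \<open>This is the Fourier multiplier \<open>M\<close> of the overview for a constant radius
  \<open>r\<close>. Values in \<open>ennreal\<close> let Tonelli be used before finiteness is
  established.\<close>

definition difference_symbol :: "real \<Rightarrow> real \<Rightarrow> 'a::euclidean_space \<Rightarrow> ennreal" where
  "difference_symbol s r \<xi> = (\<integral>\<^sup>+h\<in>ball 0 r.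
     ennreal (4 * (sin (pi * (h \<bullet> \<xi>)))\<^sup>2 / norm h powr (2 * s + real DIM('a))) \<partial>lborel)"

text \<open>Tonelli brings the integral over \<open>x\<close> inside, Plancherel is applied to the
  difference of \<open>f\<close> for each fixed \<open>h\<close>, and a second use of Tonelli
  collects the multiplier.\<close>

lemma nn_integral_difference_quotient_ball:
  fixes f :: "'a::euclidean_space \<Rightarrow> real"
  assumes cont: "continuous_on UNIV f" and f: "integrable lborel f" and bound: "\<And>x. \<bar>f x\<bar> \<le> B"
  shows "(\<integral>\<^sup>+x. (\<integral>\<^sup>+h\<in>ball 0 r. ennreal (\<bar>f (x + h) - f x\<bar>\<^sup>2 / norm h powr (2 * s + real DIM('a))) \<partial>lborel) \<partial>lborel)
    = (\<integral>\<^sup>+\<xi>. difference_symbol s r \<xi> * ennreal ((cmod (fourier_transform f \<xi>))\<^sup>2) \<partial>lborel)"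
proof -
  have [measurable]: "f \<in> borel_measurable borel" using f by auto
  \<comment> \<open>The restriction to the ball is absorbed into a weight in \<open>h\<close> alone,
    which is constant for the integrals over \<open>x\<close> and \<xi>.\<close>
  let ?w = "\<lambda>h::'a. ennreal (if norm h < r then 1 / norm h powr (2 * s + real DIM('a)) else 0)"
  let ?F = "fourier_transform f"
  have diff: "(\<integral>\<^sup>+x. ennreal ((f (x + h) - f x)\<^sup>2) \<partial>lborel)
     = (\<integral>\<^sup>+\<xi>. ennreal (4 * (sin (pi * (h \<bullet> \<xi>)))\<^sup>2 * (cmod (?F \<xi>))\<^sup>2) \<partial>lborel)" for h
  proof -
    have "integrable lborel (\<lambda>x. f (x + h))"
      using lborel_integrable_affine[of 1 f h] f by (simp add: add.commute)
    then have "integrable lborel (\<lambda>x. f (x + h) - f x)" using f by simp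
    moreover have "continuous_on UNIV (\<lambda>x. f (x + h) - f x)"
      by (intro continuous_intros continuous_on_compose2[OF cont]) auto
    moreover have "\<bar>f (x + h) - f x\<bar> \<le> 2 * B" for x using bound[of x] bound[of "x + h"] by linarith
    ultimately show ?thesis
      by (subst plancherel[symmetric, of "\<lambda>x. f (x + h) - f x"]) (auto simp: fourier_transform_difference[OF f])
  qed
  have "(\<integral>\<^sup>+x. (\<integral>\<^sup>+h\<in>ball 0 r. ennreal (\<bar>f (x + h) - f x\<bar>\<^sup>2 / norm h powr (2 * s + real DIM('a))) \<partial>lborel) \<partial>lborel)
    = (\<integral>\<^sup>+x. (\<integral>\<^sup>+h. ?w h * ennreal ((f (x + h) - f x)\<^sup>2) \<partial>lborel) \<partial>lborel)"
    by (intro nn_integral_cong) (auto simp: indicator_def simp flip: ennreal_mult)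
  also have "\<dots> = (\<integral>\<^sup>+h. (\<integral>\<^sup>+x. ?w h * ennreal ((f (x + h) - f x)\<^sup>2) \<partial>lborel) \<partial>lborel)"
    by (rule lborel_pair.Fubini') measurable
  also have "\<dots> = (\<integral>\<^sup>+h. ?w h * (\<integral>\<^sup>+x. ennreal ((f (x + h) - f x)\<^sup>2) \<partial>lborel) \<partial>lborel)"
    by (intro nn_integral_cong nn_integral_cmult) measurable
  also have "\<dots> = (\<integral>\<^sup>+h. (\<integral>\<^sup>+\<xi>. ?w h * ennreal (4 * (sin (pi * (h \<bullet> \<xi>)))\<^sup>2 * (cmod (?F \<xi>))\<^sup>2) \<partial>lborel) \<partial>lborel)"
    unfolding diff by (intro nn_integral_cong nn_integral_cmult[symmetric]) measurable
  also have "\<dots> = (\<integral>\<^sup>+\<xi>. (\<integral>\<^sup>+h. ?w h * ennreal (4 * (sin (pi * (h \<bullet> \<xi>)))\<^sup>2 * (cmod (?F \<xi>))\<^sup>2) \<partial>lborel) \<partial>lborel)"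
    by (rule lborel_pair.Fubini') measurable
  also have "\<dots> = (\<integral>\<^sup>+\<xi>. difference_symbol s r \<xi> * ennreal ((cmod (?F \<xi>))\<^sup>2) \<partial>lborel)"
    unfolding difference_symbol_def
    by (intro nn_integral_cong, subst nn_integral_multc[symmetric])
       (auto intro!: nn_integral_cong simp: indicator_def simp flip: ennreal_mult)
  finally show ?thesis .
qed

text \<open>The linear bound on the sine yields the quadratic estimate; here \<open>s < 1\<close>
  gives convergence at the origin. For the other power, the integral is split at radius
  \<open>1 / norm \<xi>\<close>, where the phase is of order one, and the trivial bound on the sine
  is used outside; there \<open>0 < s\<close> gives convergence at infinity.\<close>

lemma difference_symbol_upper:
  fixes s r :: real
  assumes s: "0 < s" "s < 1" and "0 < r"
  obtains C where "0 < C"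
    "\<And>\<xi>::'a::euclidean_space. difference_symbol s r \<xi> \<le> ennreal (C * min (norm \<xi> powr (2 * s)) ((norm \<xi>)\<^sup>2))"
proof -
  let ?n = "real DIM('a)"
  obtain C1 where C1: "0 < C1" "\<And>R. 0 < R \<Longrightarrow>
      (\<integral>\<^sup>+h\<in>ball 0 R. ennreal (norm (h::'a) powr ((2 - 2 * s) - ?n)) \<partial>lborel) \<le> ennreal (C1 * R powr (2 - 2 * s))"
    using nn_integral_norm_powr_ball[of "2 - 2 * s", where 'a='a] s by auto
  obtain C2 where C2: "0 < C2" "\<And>R. 0 < R \<Longrightarrow>
      (\<integral>\<^sup>+h\<in>- ball 0 R. ennreal (norm (h::'a) powr (- (2 * s) - ?n)) \<partial>lborel) \<le> ennreal (C2 * R powr (- (2 * s)))"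
    using nn_integral_norm_powr_outside_ball[of "2 * s", where 'a='a] s by auto
  let ?g = "\<lambda>\<xi> h::'a. ennreal (4 * (sin (pi * (h \<bullet> \<xi>)))\<^sup>2 / norm h powr (2 * s + ?n))"
  \<comment> \<open>The radius is arbitrary because the estimate is used with \<open>r\<close> for
    small frequencies and with \<open>1 / norm \<xi>\<close> inside \<open>far\<close>.\<close>
  have near: "difference_symbol s R \<xi> \<le> ennreal (4 * pi\<^sup>2 * (norm \<xi>)\<^sup>2 * (C1 * R powr (2 - 2 * s)))"
    if "0 < R" for R and \<xi> :: 'a
  proof -
    have pw: "4 * (sin (pi * (h \<bullet> \<xi>)))\<^sup>2 / norm h powr (2 * s + ?n)
       \<le> 4 * pi\<^sup>2 * (norm \<xi>)\<^sup>2 * norm h powr ((2 - 2 * s) - ?n)" for h :: 'a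
    proof (cases "h = 0")
      case False
      have "\<bar>sin (pi * (h \<bullet> \<xi>))\<bar> \<le> \<bar>pi * (h \<bullet> \<xi>)\<bar>" by (rule abs_sin_x_le_abs_x)
      also have "\<dots> \<le> pi * (norm h * norm \<xi>)" using Cauchy_Schwarz_ineq2 by (simp add: abs_mult)
      finally have "(sin (pi * (h \<bullet> \<xi>)))\<^sup>2 \<le> (pi * (norm h * norm \<xi>))\<^sup>2"
        by (metis abs_ge_zero power2_abs power_mono)
      then have "4 * (sin (pi * (h \<bullet> \<xi>)))\<^sup>2 / norm h powr (2 * s + ?n)
          \<le> 4 * pi\<^sup>2 * (norm \<xi>)\<^sup>2 * ((norm h)\<^sup>2 / norm h powr (2 * s + ?n))"
        by (simp add: power_mult_distrib field_simps divide_right_mono)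
      also have "(norm h)\<^sup>2 / norm h powr (2 * s + ?n) = norm h powr ((2 - 2 * s) - ?n)"
        using False by (simp add: powr_diff powr_add)
      finally show ?thesis .
    qed simp
    have "difference_symbol s R \<xi> \<le> (\<integral>\<^sup>+h. ennreal (4 * pi\<^sup>2 * (norm \<xi>)\<^sup>2) *
       (ennreal (norm (h::'a) powr ((2 - 2 * s) - ?n)) * indicator (ball 0 R) h) \<partial>lborel)"
      unfolding difference_symbol_def mult.assoc[of "ennreal _" "ennreal _", symmetric]
      by (intro nn_integral_mono mult_right_mono
            order_trans[OF ennreal_leI[OF pw] eq_refl[OF ennreal_mult]]) auto
    also have "\<dots> \<le> ennreal (4 * pi\<^sup>2 * (norm \<xi>)\<^sup>2) * ennreal (C1 * R powr (2 - 2 * s))"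
      by (subst nn_integral_cmult, measurable) (intro mult_left_mono C1(2)[OF that], simp)
    also have "\<dots> = ennreal (4 * pi\<^sup>2 * (norm \<xi>)\<^sup>2 * (C1 * R powr (2 - 2 * s)))"
      using C1(1) by (intro ennreal_mult[symmetric]) auto
    finally show ?thesis .
  qed
  have far: "difference_symbol s r \<xi> \<le> ennreal ((4 * pi\<^sup>2 * C1 + 4 * C2) * norm \<xi> powr (2 * s))" if "\<xi> \<noteq> 0" for \<xi> :: 'a
  proof -
    let ?R = "1 / norm \<xi>"
    have R: "0 < ?R" using that by simp
    have pw: "?g \<xi> h * indicator (ball 0 r) h
       \<le> ?g \<xi> h * indicator (ball 0 ?R) h + 4 * (ennreal (norm h powr (- (2 * s) - ?n)) * indicator (- ball 0 ?R) h)" for h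
    proof (cases "h \<in> ball 0 ?R")
      case False
      have "(sin (pi * (h \<bullet> \<xi>)))\<^sup>2 \<le> 1" using abs_square_le_1 abs_sin_le_one by blast
      then have "4 * (sin (pi * (h \<bullet> \<xi>)))\<^sup>2 / norm h powr (2 * s + ?n) \<le> 4 / norm h powr (2 * s + ?n)"
        by (intro divide_right_mono) auto
      also have "\<dots> = 4 * norm h powr (- (2 * s) - ?n)"
        using powr_minus_divide[of "norm h" "2 * s + ?n"] by simp
      finally have "?g \<xi> h \<le> 4 * ennreal (norm h powr (- (2 * s) - ?n))"
        by (simp add: ennreal_leI flip: ennreal_numeral ennreal_mult)
      then show ?thesis using False by (auto simp: indicator_def)
    qed (auto simp: indicator_def)
    have "difference_symbol s r \<xi> \<le> (\<integral>\<^sup>+h. ?g \<xi> h * indicator (ball 0 ?R) h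
        + 4 * (ennreal (norm h powr (- (2 * s) - ?n)) * indicator (- ball 0 ?R) h) \<partial>lborel)"
      unfolding difference_symbol_def by (intro nn_integral_mono pw)
    also have "\<dots> = difference_symbol s ?R \<xi>
        + 4 * (\<integral>\<^sup>+h\<in>- ball 0 ?R. ennreal (norm (h::'a) powr (- (2 * s) - ?n)) \<partial>lborel)"
      unfolding difference_symbol_def by (subst nn_integral_add) (auto simp: nn_integral_cmult)
    also have "\<dots> \<le> ennreal (4 * pi\<^sup>2 * (norm \<xi>)\<^sup>2 * (C1 * ?R powr (2 - 2 * s))) + 4 * ennreal (C2 * ?R powr (- (2 * s)))"
      by (intro add_mono near[OF R] mult_left_mono C2(2)[OF R]) auto
    also have "\<dots> = ennreal (4 * pi\<^sup>2 * (norm \<xi>)\<^sup>2 * (C1 * ?R powr (2 - 2 * s)) + 4 * (C2 * ?R powr (- (2 * s))))"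
      using C1(1) C2(1) by (simp add: ennreal_plus ennreal_mult)
    also have "?R powr (- (2 * s)) = norm \<xi> powr (2 * s)"
      using that by (simp add: powr_divide powr_minus)
    also have "?R powr (2 - 2 * s) = norm \<xi> powr (2 * s) / (norm \<xi>)\<^sup>2"
      using that powr_realpow[of "norm \<xi>" 2] by (simp add: powr_divide powr_diff)
    also have "4 * pi\<^sup>2 * (norm \<xi>)\<^sup>2 * (C1 * (norm \<xi> powr (2 * s) / (norm \<xi>)\<^sup>2)) + 4 * (C2 * norm \<xi> powr (2 * s))
       = (4 * pi\<^sup>2 * C1 + 4 * C2) * norm \<xi> powr (2 * s)" using that by (simp add: algebra_simps)
    finally show ?thesis .
  qed
  \<comment> \<open>The sum of the constants of both estimates, so that each estimate holds with
    \<open>?C\<close> and the minimum follows.\<close>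
  let ?C = "4 * pi\<^sup>2 * (C1 * r powr (2 - 2 * s)) + (4 * pi\<^sup>2 * C1 + 4 * C2)"
  show ?thesis
  proof
    show "0 < ?C" using C1 C2 by (intro add_nonneg_pos) auto
    fix \<xi> :: 'a
    have 1: "difference_symbol s r \<xi> \<le> ennreal (?C * (norm \<xi>)\<^sup>2)"
      by (rule order_trans[OF near[OF \<open>0 < r\<close>]])
         (use C1 C2 in \<open>auto intro!: ennreal_leI simp: algebra_simps\<close>)
    have 2: "difference_symbol s r \<xi> \<le> ennreal (?C * norm \<xi> powr (2 * s))"
    proof (cases "\<xi> = 0")
      case False
      show ?thesis
        by (rule order_trans[OF far[OF False]])
           (use C1 C2 in \<open>auto intro!: ennreal_leI mult_right_mono\<close>)
    qed (simp add: difference_symbol_def)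
    show "difference_symbol s r \<xi> \<le> ennreal (?C * min (norm \<xi> powr (2 * s)) ((norm \<xi>)\<^sup>2))"
      using 1 2 by (simp add: min_def)
  qed
qed

text \<open>The Taylor remainder of order two is at most half the square of \<open>t\<close>, hence
  at most \<open>t / 2\<close> on the unit interval.\<close>

lemma sin_ge_half:
  fixes t :: real
  assumes "0 \<le> t" "t \<le> 1"
  shows "t / 2 \<le> sin t"
proof -
  have "\<bar>sin t - t\<bar> \<le> t\<^sup>2 / 2"
    using Maclaurin_sin_bound[of t 2] by (simp add: numeral_2_eq_2 sin_coeff_def)
  moreover have "t\<^sup>2 \<le> t" using assms by (simp add: power2_eq_square mult_left_le)
  ultimately show ?thesis by linarith
qed

text \<open>On the ball of radius \<open>\<rho> / 4\<close> around \<open>\<rho> \<xi> / (2 \<bar>\<xi>\<bar>)\<close>, where \<open>\<rho> = min r (1 / (4 \<bar>\<xi>\<bar>))\<close>,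
  the argument \<open>\<pi> h \<cdot> \<xi>\<close> of the sine is positive, at most \<open>1\<close>, and comparable to \<open>\<rho> \<bar>\<xi>\<bar>\<close>.\<close>

lemma difference_symbol_lower:
  fixes s r :: real
  assumes s: "0 < s" "s < 1" and r: "0 < r"
  obtains c where "0 < c"
    "\<And>\<xi>::'a::euclidean_space. ennreal (c * min (norm \<xi> powr (2 * s)) ((norm \<xi>)\<^sup>2)) \<le> difference_symbol s r \<xi>"
proof
  let ?n = "real DIM('a)"
  \<comment> \<open>The power of 4 comes from the volume of a ball of radius \<rho> / 4, the other 4
    from the pointwise bound \<open>?v\<close> below.\<close>
  define q where "q = unit_ball_vol ?n / (4 * 4 ^ DIM('a))"
  have q: "0 < q" unfolding q_def by (simp add: unit_ball_vol_pos)
  \<comment> \<open>One entry for each of the two possible values of \<rho>, namely \<open>r\<close>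
    and \<open>1 / (4 * norm \<xi>)\<close>.\<close>
  define m where "m = min (r powr (2 - 2 * s)) ((1 / 4) powr (2 - 2 * s))"
  show "0 < q * m" using q r by (auto simp: m_def)
  fix \<xi> :: 'a
  show "ennreal (q * m * min (norm \<xi> powr (2 * s)) ((norm \<xi>)\<^sup>2)) \<le> difference_symbol s r \<xi>"
  proof (cases "\<xi> = 0")
    case False
    define \<rho> where "\<rho> = min r (1 / (4 * norm \<xi>))"
    have \<rho>: "0 < \<rho>" "\<rho> \<le> r" "\<rho> * norm \<xi> \<le> 1 / 4"
      using False r by (auto simp: \<rho>_def min_def field_simps)
    define a where "a = (\<rho> / (2 * norm \<xi>)) *\<^sub>R \<xi>"
    have norm_a: "norm a = \<rho> / 2" and a_inner: "a \<bullet> \<xi> = \<rho> * norm \<xi> / 2"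
      using False \<rho> by (auto simp: a_def power2_norm_eq_inner[symmetric] power2_eq_square)
    \<comment> \<open>On the small ball the sine is at least \<open>\<rho> * norm \<xi> / 4\<close>,
      which gives the numerator, and \<open>norm h < \<rho>\<close> bounds the denominator.\<close>
    let ?v = "\<rho>\<^sup>2 * (norm \<xi>)\<^sup>2 / 4 / \<rho> powr (2 * s + ?n)"
    have pw: "h \<in> ball 0 r \<and> ?v \<le> 4 * (sin (pi * (h \<bullet> \<xi>)))\<^sup>2 / norm h powr (2 * s + ?n)"
      if h: "h \<in> ball a (\<rho> / 4)" for h
    proof -
      have d: "norm (h - a) < \<rho> / 4" using h by (simp add: dist_norm norm_minus_commute)
      have nh: "norm h < \<rho>" using norm_triangle_ineq2[of h a] d norm_a \<rho>(1) by linarith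
      have "\<bar>(h - a) \<bullet> \<xi>\<bar> \<le> \<rho> / 4 * norm \<xi>"
        by (rule order_trans[OF Cauchy_Schwarz_ineq2 mult_right_mono[OF less_imp_le[OF d]]]) simp
      then have lo: "\<rho> * norm \<xi> / 4 \<le> h \<bullet> \<xi>" and hi: "h \<bullet> \<xi> \<le> 3 * (\<rho> * norm \<xi>) / 4"
        unfolding inner_diff_left a_inner abs_le_iff by linarith+
      have pos: "0 \<le> \<rho> * norm \<xi>" using \<rho> by simp
      have up: "pi * (h \<bullet> \<xi>) \<le> 1"
      proof -
        have "pi * (h \<bullet> \<xi>) \<le> 4 * (3 / 16)"
          \<comment> \<open>The inner product is at most three quarters of
            \<open>\<rho> * norm \<xi>\<close>, which is at most 1/4; this gives 3/16.\<close>
          using pi_less_4 hi \<rho>(3) lo pos by (intro mult_mono) linarith+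
        then show ?thesis by simp
      qed
      have "\<rho> * norm \<xi> / 4 \<le> 2 * (\<rho> * norm \<xi> / 4) / 2" by simp
      also have "\<dots> \<le> pi * (h \<bullet> \<xi>) / 2"
        using pi_ge_two lo pos by (intro divide_right_mono mult_mono) auto
      also have "\<dots> \<le> sin (pi * (h \<bullet> \<xi>))"
        using up lo pos by (intro sin_ge_half) auto
      finally have "(\<rho> * norm \<xi> / 4)\<^sup>2 \<le> (sin (pi * (h \<bullet> \<xi>)))\<^sup>2" using pos by (intro power_mono) auto
      then have num: "\<rho>\<^sup>2 * (norm \<xi>)\<^sup>2 / 4 \<le> 4 * (sin (pi * (h \<bullet> \<xi>)))\<^sup>2"
        by (simp add: power_mult_distrib power_divide)
      have "h \<noteq> 0" using lo \<rho> False by (auto simp: mult_le_0_iff)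
      then have "?v \<le> 4 * (sin (pi * (h \<bullet> \<xi>)))\<^sup>2 / norm h powr (2 * s + ?n)"
        using num nh s by (intro frac_le powr_mono2) auto
      then show ?thesis using nh \<rho> by simp
    qed
    have fin: "ennreal (q * (norm \<xi>)\<^sup>2 * \<rho> powr (2 - 2 * s)) \<le> difference_symbol s r \<xi>"
    proof -
      have "q * (norm \<xi>)\<^sup>2 * \<rho> powr (2 - 2 * s) = ?v * (unit_ball_vol ?n * (\<rho> / 4) ^ DIM('a))"
        using \<rho> powr_realpow[of \<rho> 2] powr_realpow[of \<rho> "DIM('a)"]
        by (simp add: q_def powr_diff powr_add power_divide mult_ac)
      then have "ennreal (q * (norm \<xi>)\<^sup>2 * \<rho> powr (2 - 2 * s)) = ennreal ?v * emeasure lborel (ball a (\<rho> / 4))"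
        using \<rho> by (simp add: emeasure_ball flip: ennreal_mult)
      also have "\<dots> = (\<integral>\<^sup>+h. ennreal ?v * indicator (ball a (\<rho> / 4)) h \<partial>lborel)"
        by (simp add: nn_integral_cmult_indicator)
      also have "\<dots> \<le> difference_symbol s r \<xi>"
        unfolding difference_symbol_def
        by (intro nn_integral_mono) (use pw in \<open>auto simp: indicator_def intro!: ennreal_leI\<close>)
      finally show ?thesis .
    qed
    \<comment> \<open>If \<rho> equals \<open>r\<close>, the right side is quadratic in
      \<open>norm \<xi>\<close>; if \<rho> equals \<open>1 / (4 * norm \<xi>)\<close>, it is a
      multiple of \<open>norm \<xi> powr (2 * s)\<close>. Either way the minimum is below
      it.\<close>
    have "m * min (norm \<xi> powr (2 * s)) ((norm \<xi>)\<^sup>2) \<le> (norm \<xi>)\<^sup>2 * \<rho> powr (2 - 2 * s)"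
    proof (cases "r \<le> 1 / (4 * norm \<xi>)")
      case True
      have "m * min (norm \<xi> powr (2 * s)) ((norm \<xi>)\<^sup>2) \<le> r powr (2 - 2 * s) * (norm \<xi>)\<^sup>2"
        by (intro mult_mono) (auto simp: m_def)
      then show ?thesis using True by (simp add: \<rho>_def mult.commute)
    next
      case F: False
      have "\<rho> powr (2 - 2 * s) = (1 / 4 / norm \<xi>) powr (2 - 2 * s)" using F by (simp add: \<rho>_def)
      also have "\<dots> = (1 / 4) powr (2 - 2 * s) * (norm \<xi> powr (2 * s) / (norm \<xi>)\<^sup>2)"
        using False powr_realpow[of "norm \<xi>" 2] by (simp only: powr_divide powr_diff) (simp add: field_simps)
      finally have "(norm \<xi>)\<^sup>2 * \<rho> powr (2 - 2 * s) = (1 / 4) powr (2 - 2 * s) * norm \<xi> powr (2 * s)"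
        using False by simp
      also have "\<dots> \<ge> m * min (norm \<xi> powr (2 * s)) ((norm \<xi>)\<^sup>2)"
        by (intro mult_mono) (auto simp: m_def)
      finally show ?thesis .
    qed
    then have "ennreal (q * m * min (norm \<xi> powr (2 * s)) ((norm \<xi>)\<^sup>2)) \<le> ennreal (q * (norm \<xi>)\<^sup>2 * \<rho> powr (2 - 2 * s))"
      using q by (auto intro!: ennreal_leI simp: mult.assoc)
    with fin show ?thesis by (rule order_trans[rotated])
  qed simp
qed

section \<open>Comparison of the variable radius with constant radii\<close>

text \<open>The identity includes the value \<infinity>, so the squared seminorm is the double
  integral even when that diverges.\<close>

lemma ennreal_sqrt_power2: "(ennreal_sqrt x)\<^sup>2 = x"
proof (cases x)
  case (real a)
  then show ?thesis by (simp add: ennreal_sqrt_def ennreal_power)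
qed (simp add: ennreal_sqrt_def power2_eq_square ennreal_top_mult)

theorem proposition3p18:
  fixes s :: real and \<sigma> :: "real ^ 'n \<Rightarrow> ereal"
  assumes "0 < s" and "s < 1"
    and "screening_function \<sigma>" and "\<And>x. \<sigma> x < \<infinity>"
    and "0 < (INF x. \<sigma> x)" and "(SUP x. \<sigma> x) < \<infinity>"
  shows "\<exists>c::real. 0 < c \<and> (\<forall>f :: real ^ 'n \<Rightarrow> real. schwartz f \<longrightarrow>
     ennreal (inverse c) * (\<integral>\<^sup>+ \<xi>. ennreal (min (norm \<xi> powr (2 * s)) ((norm \<xi>)\<^sup>2)
                                   * (cmod (fourier_transform f \<xi>))\<^sup>2) \<partial>lborel)
       \<le> (screened_seminorm \<sigma> s f)\<^sup>2 \<and>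
     (screened_seminorm \<sigma> s f)\<^sup>2
       \<le> ennreal c * (\<integral>\<^sup>+ \<xi>. ennreal (min (norm \<xi> powr (2 * s)) ((norm \<xi>)\<^sup>2)
                                   * (cmod (fourier_transform f \<xi>))\<^sup>2) \<partial>lborel))"
proof -
  \<comment> \<open>The infimum is an extended real, so a real number is chosen strictly between 0
    and it; dually, \<open>b\<close> is chosen above the supremum.\<close>
  obtain a :: real where a: "0 < a" "\<And>x. ereal a \<le> \<sigma> x"
  proof -
    obtain a where "0 < ereal a" "ereal a < (INF x. \<sigma> x)" using ereal_dense2[OF assms(5)] by blast
    moreover have "(INF x. \<sigma> x) \<le> \<sigma> x" for x by (rule INF_lower) simp
    ultimately show ?thesis by (intro that[of a]) (auto intro: order_trans less_imp_le)
  qed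
  obtain b :: real where b: "0 < b" "\<And>x. \<sigma> x \<le> ereal b"
  proof -
    obtain b where "(SUP x. \<sigma> x) < ereal b" using ereal_dense2[OF assms(6)] by blast
    moreover have "\<sigma> x \<le> (SUP x. \<sigma> x)" for x by (rule SUP_upper) simp
    ultimately have b: "\<sigma> x \<le> ereal b" for x by (meson less_imp_le order_trans)
    from order_trans[OF a(2) b] have "0 < b" using a(1) by simp
    then show ?thesis using b by (rule that)
  qed
  obtain c1 where c1: "0 < c1" "\<And>\<xi>::real^'n. ennreal (c1 * min (norm \<xi> powr (2 * s)) ((norm \<xi>)\<^sup>2)) \<le> difference_symbol s a \<xi>"
    using difference_symbol_lower[OF assms(1,2) a(1), where 'a="real^'n"] by blast
  obtain c2 where c2: "0 < c2" "\<And>\<xi>::real^'n. difference_symbol s b \<xi> \<le> ennreal (c2 * min (norm \<xi> powr (2 * s)) ((norm \<xi>)\<^sup>2))"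
    using difference_symbol_upper[OF assms(1,2) b(1), where 'a="real^'n"] by blast
  \<comment> \<open>The single constant must satisfy both \<open>c2 \<le> ?c\<close> and
    \<open>inverse ?c \<le> c1\<close>.\<close>
  let ?c = "max c2 (inverse c1)"
  have c: "0 < ?c" using c2 by simp
  have cinv: "inverse ?c \<le> c1"
    using c1(1) c2(1) le_imp_inverse_le[of "inverse c1" ?c] by simp
  show ?thesis
  proof (intro exI[of _ ?c] conjI allI impI c)
    fix f :: "real ^ 'n \<Rightarrow> real"
    assume f: "schwartz f"
    obtain B where B: "\<And>x. \<bar>f x\<bar> \<le> B" using schwartz_bounded[OF f] by blast
    note energy = nn_integral_difference_quotient_ball[OF schwartz_continuous[OF f] schwartz_integrable[OF f] B, where s=s]
    have [measurable]: "f \<in> borel_measurable borel"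
      by (rule borel_measurable_continuous_onI[OF schwartz_continuous[OF f]])
    let ?m = "\<lambda>\<xi>::real^'n. min (norm \<xi> powr (2 * s)) ((norm \<xi>)\<^sup>2)"
    let ?F = "\<lambda>\<xi>. (cmod (fourier_transform f \<xi>))\<^sup>2"
    let ?g = "\<lambda>x h. ennreal (\<bar>f (x + h) - f x\<bar>\<^sup>2 / norm h powr (2 * s + real DIM(real^'n)))"
    have scale: "ennreal k * (\<integral>\<^sup>+ \<xi>. ennreal (?m \<xi> * ?F \<xi>) \<partial>lborel)
       = (\<integral>\<^sup>+ \<xi>. ennreal (k * ?m \<xi>) * ennreal (?F \<xi>) \<partial>lborel)" if "0 < k" for k
      using that by (subst nn_integral_cmult[symmetric])
        (auto intro!: nn_integral_cong simp: mult.assoc simp flip: ennreal_mult)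
    have semi: "(screened_seminorm \<sigma> s f)\<^sup>2 = (\<integral>\<^sup>+ x. (\<integral>\<^sup>+ h\<in>{h. ereal (norm h) < \<sigma> x}. ?g x h \<partial>lborel) \<partial>lborel)"
      unfolding screened_seminorm_def ennreal_sqrt_power2 ..
    have "ennreal (inverse ?c) * (\<integral>\<^sup>+ \<xi>. ennreal (?m \<xi> * ?F \<xi>) \<partial>lborel)
       \<le> ennreal c1 * (\<integral>\<^sup>+ \<xi>. ennreal (?m \<xi> * ?F \<xi>) \<partial>lborel)"
      using cinv by (intro mult_right_mono ennreal_leI) auto
    also have "\<dots> \<le> (\<integral>\<^sup>+ \<xi>. difference_symbol s a \<xi> * ennreal (?F \<xi>) \<partial>lborel)"
      unfolding scale[OF c1(1)] by (intro nn_integral_mono mult_right_mono c1(2)) auto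
    also have "\<dots> = (\<integral>\<^sup>+ x. (\<integral>\<^sup>+ h\<in>ball 0 a. ?g x h \<partial>lborel) \<partial>lborel)" by (rule energy[symmetric])
    \<comment> \<open>Only the domain of the inner integral grows: the ball of radius
      \<open>a\<close> lies in every screened ball.\<close>
    also have "\<dots> \<le> (screened_seminorm \<sigma> s f)\<^sup>2"
      unfolding semi
      by (intro nn_integral_mono mult_left_mono)
         (auto simp: indicator_def intro: order_less_le_trans[OF _ a(2)])
    finally show "ennreal (inverse ?c) * (\<integral>\<^sup>+ \<xi>. ennreal (?m \<xi> * ?F \<xi>) \<partial>lborel) \<le> (screened_seminorm \<sigma> s f)\<^sup>2" .
    have "(screened_seminorm \<sigma> s f)\<^sup>2 \<le> (\<integral>\<^sup>+ x. (\<integral>\<^sup>+ h\<in>ball 0 b. ?g x h \<partial>lborel) \<partial>lborel)"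
      unfolding semi using order_less_le_trans[OF _ b(2)]
      by (intro nn_integral_mono mult_left_mono) (fastforce simp: indicator_def)+
    also have "\<dots> = (\<integral>\<^sup>+ \<xi>. difference_symbol s b \<xi> * ennreal (?F \<xi>) \<partial>lborel)" by (rule energy)
    also have "\<dots> \<le> ennreal c2 * (\<integral>\<^sup>+ \<xi>. ennreal (?m \<xi> * ?F \<xi>) \<partial>lborel)"
      unfolding scale[OF c2(1)] by (intro nn_integral_mono mult_right_mono c2(2)) auto
    also have "\<dots> \<le> ennreal ?c * (\<integral>\<^sup>+ \<xi>. ennreal (?m \<xi> * ?F \<xi>) \<partial>lborel)"
      by (intro mult_right_mono ennreal_leI) auto
    finally show "(screened_seminorm \<sigma> s f)\<^sup>2 \<le> ennreal ?c * (\<integral>\<^sup>+ \<xi>. ennreal (?m \<xi> * ?F \<xi>) \<partial>lborel)" .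
  qed
qed

end
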